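(* Let $\beta>0$ and let $\xi$ be a positive random variable such that $$-\log P[\xi>t]\sim c\,t^{\beta}\quad\text{as } t\to\infty$$ for some constant $c>0$. Let $Y$ be a one-dimensional Brownian motion started at $0$, independent of $\xi$, and let $\eta_{(-\xi,\xi)}=\inf\{t\ge0: Y_t\notin(-\xi,\xi)\}$. Then, as $t\to\infty$, $$-\log P[\eta_{(-\xi,\xi)}>t]\sim 2^{-\frac{2\beta}{2+\beta}}\Big(\frac{2+\beta}{2}\Big)c^{2/(2+\beta)}\beta^{-\beta/(2+\beta)}\pi^{2\beta/(2+\beta)}\,t^{\beta/(2+\beta)}.$$
   Context: $f(t)\sim g(t)$ as $t\to\infty$ means $f(t)/g(t)\to1$. *)

theory Defs
  imports "HOL-Probability.Probability" "HOL-Library.Landau_Symbols"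
begin

definition brownian_motion :: "'a measure \<Rightarrow> (real \<Rightarrow> 'a \<Rightarrow> real) \<Rightarrow> bool" where
  "brownian_motion M Y \<longleftrightarrow>
     prob_space M \<and>
     (\<forall>t\<ge>0. Y t \<in> borel_measurable M) \<and>
     (\<forall>\<omega>\<in>space M. Y 0 \<omega> = 0) \<and>
     (\<forall>\<omega>\<in>space M. continuous_on {0..} (\<lambda>t. Y t \<omega>)) \<and>
     (\<forall>s t. 0 \<le> s \<and> s < t \<longrightarrow>
        distributed M lborel (\<lambda>\<omega>. Y t \<omega> - Y s \<omega>)
          (\<lambda>x. ennreal (normal_density 0 (sqrt (t - s)) x))) \<and>
     (\<forall>ts. sorted_wrt (<) ts \<and> (\<forall>t\<in>set ts. 0 \<le> t) \<longrightarrow>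
        prob_space.indep_vars M (\<lambda>_. borel)
          (\<lambda>i \<omega>. Y (ts ! Suc i) \<omega> - Y (ts ! i) \<omega>) {..<length ts - 1})"

definition exit_time :: "(real \<Rightarrow> 'a \<Rightarrow> real) \<Rightarrow> ('a \<Rightarrow> real) \<Rightarrow> 'a \<Rightarrow> real" where
  "exit_time Y a \<omega> = Inf {t. 0 \<le> t \<and> Y t \<omega> \<notin> {- a \<omega> <..< a \<omega>}}"

end

theory Submission
  imports Defs
begin

text \<open>
  For a Brownian motion observed at the times \<open>k h\<close>, the addition theorem and independence of
  increments give \<open>E[D\<^sub>k cos (a Y\<^sub>(\<^sub>k\<^sub>+\<^sub>1\<^sub>)\<^sub>h)] = exp (- a\<^sup>2 h / 2) E[D\<^sub>k cos (a Y\<^sub>k\<^sub>h)]\<close>, where \<open>D\<^sub>k\<close> indicates that the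
  walk has stayed in \<open>(-r, r)\<close> up to step \<open>k\<close>. Where the walk has just left the interval, the cosine has
  a favourable sign unless the last increment was large, which by the fourth moment costs only \<open>O(h)\<close>
  in total over a bounded time span. As \<open>h \<rightarrow> 0\<close>, taking \<open>a = pi / (2 r)\<close> yields the lower bound
  \<open>exp (- pi\<^sup>2 t / (8 r\<^sup>2))\<close> for the probability of staying in \<open>(-r, r)\<close> up to time \<open>t\<close>, and taking
  \<open>a = pi / (2 R)\<close> with \<open>R > r\<close> yields the upper bound \<open>exp (- pi\<^sup>2 t / (8 R\<^sup>2)) / cos (pi r / (2 R))\<close>.
  With \<open>\<xi> \<approx> \<rho> t\<^sup>1\<^sup>/\<^sup>(\<^sup>2\<^sup>+\<^sup>\<beta>\<^sup>)\<close> both the tail of \<open>\<xi>\<close> and the confinement cost are of order \<open>t\<^sup>\<beta>\<^sup>/\<^sup>(\<^sup>2\<^sup>+\<^sup>\<beta>\<^sup>)\<close>, so by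
  Laplace's principle the constant is the minimum over \<open>\<rho>\<close> of \<open>c \<rho>\<^sup>\<beta> + pi\<^sup>2 / (8 \<rho>\<^sup>2)\<close>.
\<close>

subsection \<open>Gaussian random walks\<close>

text \<open>Both values are read off the characteristic function of the standard normal law, as its
  real and imaginary parts, after rescaling \<open>X\<close> by \<open>\<sigma>\<close>.\<close>

lemma (in prob_space) normal_expectation_cos_sin:
  assumes \<sigma>: "0 < \<sigma>" and D: "distributed M lborel X (\<lambda>x. ennreal (normal_density 0 \<sigma> x))"
  shows "expectation (\<lambda>\<omega>. cos (a * X \<omega>)) = exp (- (a * \<sigma>)\<^sup>2 / 2)"
    and "expectation (\<lambda>\<omega>. sin (a * X \<omega>)) = 0"
proof -
  interpret N: real_distribution std_normal_distribution
    by (rule real_dist_normal_dist)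
  define Z where "Z = (\<lambda>\<omega>. X \<omega> / \<sigma>)"
  have Z: "distributed M lborel Z (\<lambda>x. ennreal (std_normal_density x))"
    using D normal_standard_normal_convert[OF \<sigma>, of X 0] by (simp add: Z_def)
  have [measurable]: "Z \<in> borel_measurable M"
    using distributed_measurable[OF Z] by simp
  have distr: "distr M lborel Z = std_normal_distribution"
    using Z by (rule distributed_distr_eq_density)
  have int: "integrable std_normal_distribution (\<lambda>x. iexp (a * \<sigma> * x))"
    by (rule N.integrable_const_bound[where B=1]) auto
  have char: "(CLINT x|std_normal_distribution. iexp (a * \<sigma> * x)) = complex_of_real (exp (- (a * \<sigma>)\<^sup>2 / 2))"
    using fun_cong[OF char_std_normal_distribution, of "a * \<sigma>"] by (simp add: char_def)
  have aX: "a * X \<omega> = a * \<sigma> * Z \<omega>" for \<omega>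
    using \<sigma> by (simp add: Z_def)
  have "expectation (\<lambda>\<omega>. cos (a * X \<omega>)) = (LINT x|std_normal_distribution. cos (a * \<sigma> * x))"
    unfolding aX distr[symmetric] by (subst integral_distr) auto
  also have "\<dots> = (LINT x|std_normal_distribution. Re (iexp (a * \<sigma> * x)))"
    by (simp add: Re_exp)
  also have "\<dots> = exp (- (a * \<sigma>)\<^sup>2 / 2)"
    using integral_Re[OF int] char by simp
  finally show "expectation (\<lambda>\<omega>. cos (a * X \<omega>)) = exp (- (a * \<sigma>)\<^sup>2 / 2)" .
  have "expectation (\<lambda>\<omega>. sin (a * X \<omega>)) = (LINT x|std_normal_distribution. sin (a * \<sigma> * x))"
    unfolding aX distr[symmetric] by (subst integral_distr) auto
  also have "\<dots> = (LINT x|std_normal_distribution. Im (iexp (a * \<sigma> * x)))"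
    by (simp add: Im_exp)
  also have "\<dots> = 0"
    using integral_Im[OF int] char by simp
  finally show "expectation (\<lambda>\<omega>. sin (a * X \<omega>)) = 0" .
qed

lemma (in prob_space) integrable_event_indicator:
  "A \<in> events \<Longrightarrow> integrable M (indicator A :: 'a \<Rightarrow> real)"
  by (rule integrable_const_bound[where B=1]) (auto simp: indicator_def)

lemma (in prob_space) integrable_indicator_mult:
  fixes f :: "'a \<Rightarrow> real"
  assumes [measurable]: "f \<in> borel_measurable M" "A \<in> events" and "\<And>x. \<bar>f x\<bar> \<le> 1"
  shows "integrable M (\<lambda>\<omega>. indicator A \<omega> * f \<omega>)"
  by (rule integrable_const_bound[where B=1]) (use assms in \<open>auto simp: indicator_def\<close>)

text \<open>Markov's inequality for the fourth power. The fourth moment makes the bound of order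
  \<sigma>^4, so that summed over \<open>n\<close> steps of variance \<open>t / n\<close> it is of
  order \<open>1 / n\<close>; the second moment would leave an error that does not vanish.\<close>

lemma (in prob_space) normal_tail_fourth_moment:
  assumes \<sigma>: "0 < \<sigma>" and D: "distributed M lborel X (\<lambda>x. ennreal (normal_density 0 \<sigma> x))"
    and d: "0 < d"
  shows "prob {\<omega>\<in>space M. d \<le> \<bar>X \<omega>\<bar>} \<le> 3 * \<sigma> ^ 4 / d ^ 4"
proof -
  have [measurable]: "X \<in> borel_measurable M"
    using distributed_measurable[OF D] by simp
  have mom: "has_bochner_integral lborel (\<lambda>x. normal_density 0 \<sigma> x * x ^ 4) (3 * \<sigma> ^ 4)"
    using normal_moment_even[OF \<sigma>, of 0 2] \<sigma>
    by (simp add: fact_numeral field_simps flip: power_mult)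
  have E: "expectation (\<lambda>\<omega>. X \<omega> ^ 4) = 3 * \<sigma> ^ 4"
    using distributed_integral[OF D, of "\<lambda>x. x ^ 4"] mom
    by (simp add: has_bochner_integral_iff)
  have int: "integrable M (\<lambda>\<omega>. X \<omega> ^ 4)"
    using distributed_integrable[OF D, of "\<lambda>x. x ^ 4"] mom
    by (simp add: has_bochner_integral_iff)
  have "prob {\<omega>\<in>space M. d \<le> \<bar>X \<omega>\<bar>} = expectation (indicator {\<omega>\<in>space M. d \<le> \<bar>X \<omega>\<bar>})"
    by simp
  also have "\<dots> \<le> expectation (\<lambda>\<omega>. X \<omega> ^ 4 / d ^ 4)"
  proof (rule integral_mono)
    show "integrable M (\<lambda>\<omega>. X \<omega> ^ 4 / d ^ 4)" using int by simp
    fix \<omega>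
    have "d ^ 4 \<le> X \<omega> ^ 4" if "d \<le> \<bar>X \<omega>\<bar>"
      using power_mono[OF that, of 4] d by simp
    then show "indicator {\<omega>\<in>space M. d \<le> \<bar>X \<omega>\<bar>} \<omega> \<le> X \<omega> ^ 4 / d ^ 4"
      using d by (auto simp: indicator_def field_simps)
  qed (auto intro: integrable_event_indicator)
  finally show ?thesis using E by simp
qed

section \<open>Cosine estimates for Gaussian walks confined to an interval\<close>

locale gaussian_walk = prob_space M for M :: "'a measure" +
  fixes W :: "nat \<Rightarrow> 'a \<Rightarrow> real" and \<sigma> :: real and n :: nat
  assumes sigma_pos: "0 < \<sigma>"
    and W_start: "\<And>\<omega>. \<omega> \<in> space M \<Longrightarrow> W 0 \<omega> = 0"
    and W_measurable [measurable]: "\<And>k. W k \<in> borel_measurable M"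
    and increment_normal: "\<And>i. i < n \<Longrightarrow>
      distributed M lborel (\<lambda>\<omega>. W (Suc i) \<omega> - W i \<omega>) (\<lambda>x. ennreal (normal_density 0 \<sigma> x))"
    and increments_indep: "indep_vars (\<lambda>_. borel) (\<lambda>i \<omega>. W (Suc i) \<omega> - W i \<omega>) {..<n}"
begin

definition inside :: "real \<Rightarrow> nat \<Rightarrow> 'a set" where
  "inside r k = {\<omega>\<in>space M. \<forall>j\<le>k. \<bar>W j \<omega>\<bar> < r}"

lemma inside_sets [measurable]: "inside r k \<in> events"
  unfolding inside_def by measurable

lemma inside_Suc: "inside r (Suc k) = inside r k \<inter> {\<omega>\<in>space M. \<bar>W (Suc k) \<omega>\<bar> < r}"
  by (auto simp: inside_def le_Suc_eq)

text \<open>The walk starts at 0, so its first \<open>k\<close> positions are partial sums of the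
  first \<open>k\<close> increments. Everything before \<open>f\<close> is therefore a function of
  these increments and independent of the next one.\<close>

lemma expectation_inside_mult_increment:
  fixes f g :: "real \<Rightarrow> real"
  assumes k: "k < n" and [measurable]: "g \<in> borel_measurable borel" "f \<in> borel_measurable borel"
    and g: "\<And>x. \<bar>g x\<bar> \<le> 1" and f: "\<And>x. \<bar>f x\<bar> \<le> 1"
  shows "expectation (\<lambda>\<omega>. indicator (inside r k) \<omega> * g (W k \<omega>) * f (W (Suc k) \<omega> - W k \<omega>))
       = expectation (\<lambda>\<omega>. indicator (inside r k) \<omega> * g (W k \<omega>))
         * expectation (\<lambda>\<omega>. f (W (Suc k) \<omega> - W k \<omega>))"
proof -
  define X where "X = (\<lambda>i \<omega>. W (Suc i) \<omega> - W i \<omega>)"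
  \<comment> \<open>The indicator times \<open>g\<close>, rewritten as a function of the vector of
    increments, so that independence of disjoint blocks of increments applies to it.\<close>
  define \<Phi> where "\<Phi> = (\<lambda>x. if \<forall>j\<le>k. \<bar>\<Sum>i<j. x i\<bar> < r then g (\<Sum>i<k. x i) else (0::real))"
  have [measurable]: "\<Phi> \<in> borel_measurable (PiM {..<k} (\<lambda>_. borel))"
  proof -
    have [measurable]: "(\<lambda>x. \<Sum>i<j. x i) \<in> borel_measurable (PiM {..<k} (\<lambda>_. borel::real measure))" if "j \<le> k" for j
      using that by (intro borel_measurable_sum measurable_component_singleton) auto
    have "Measurable.pred (PiM {..<k} (\<lambda>_. borel::real measure)) (\<lambda>x. \<forall>j\<in>{..k}. \<bar>\<Sum>i<j. x i\<bar> < r)"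
      by (intro pred_intros_finite) auto
    then have [measurable]: "Measurable.pred (PiM {..<k} (\<lambda>_. borel::real measure)) (\<lambda>x. \<forall>j\<le>k. \<bar>\<Sum>i<j. x i\<bar> < r)"
      by simp
    show ?thesis unfolding \<Phi>_def by measurable
  qed
  have "indep_var (PiM {..<k} (\<lambda>_. borel)) (\<lambda>\<omega>. restrict (\<lambda>i. X i \<omega>) {..<k})
      (PiM {k} (\<lambda>_. borel)) (\<lambda>\<omega>. restrict (\<lambda>i. X i \<omega>) {k})"
    using increments_indep k unfolding X_def by (intro indep_var_restrict[where I="{..<n}"]) auto
  then have "indep_var borel (\<Phi> \<circ> (\<lambda>\<omega>. restrict (\<lambda>i. X i \<omega>) {..<k}))
      borel ((\<lambda>x. f (x k)) \<circ> (\<lambda>\<omega>. restrict (\<lambda>i. X i \<omega>) {k}))"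
    by (rule indep_var_compose) auto
  then have ind: "indep_var borel (\<lambda>\<omega>. \<Phi> (restrict (\<lambda>i. X i \<omega>) {..<k})) borel (\<lambda>\<omega>. f (X k \<omega>))"
    by (simp add: comp_def)
  have sumX: "(\<Sum>i<j. restrict (\<lambda>i. X i \<omega>) {..<k} i) = W j \<omega>" if "\<omega> \<in> space M" "j \<le> k" for \<omega> j
  proof -
    have "(\<Sum>i<j. restrict (\<lambda>i. X i \<omega>) {..<k} i) = (\<Sum>i<j. W (Suc i) \<omega> - W i \<omega>)"
      using that by (intro sum.cong) (auto simp: X_def)
    also have "\<dots> = W j \<omega>"
      using that W_start sum_lessThan_telescope[of "\<lambda>i. W i \<omega>" j] by simp
    finally show ?thesis .
  qed
  have \<Phi>: "\<Phi> (restrict (\<lambda>i. X i \<omega>) {..<k}) = indicator (inside r k) \<omega> * g (W k \<omega>)" if "\<omega> \<in> space M" for \<omega>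
  proof -
    have "(\<forall>j\<le>k. \<bar>\<Sum>i<j. restrict (\<lambda>i. X i \<omega>) {..<k} i\<bar> < r) \<longleftrightarrow> \<omega> \<in> inside r k"
      using sumX[OF that] that by (auto simp: inside_def)
    then show ?thesis
      unfolding \<Phi>_def using sumX[OF that order_refl] by (simp add: indicator_def)
  qed
  have int1: "integrable M (\<lambda>\<omega>. \<Phi> (restrict (\<lambda>i. X i \<omega>) {..<k}))"
    using integrable_indicator_mult[of "\<lambda>\<omega>. g (W k \<omega>)" "inside r k"] g
    by (subst Bochner_Integration.integrable_cong[OF refl \<Phi>]) auto
  have int2: "integrable M (\<lambda>\<omega>. f (X k \<omega>))"
    unfolding X_def by (rule integrable_const_bound[where B=1]) (use f in auto)
  have "expectation (\<lambda>\<omega>. \<Phi> (restrict (\<lambda>i. X i \<omega>) {..<k}) * f (X k \<omega>)) =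
      expectation (\<lambda>\<omega>. \<Phi> (restrict (\<lambda>i. X i \<omega>) {..<k})) * expectation (\<lambda>\<omega>. f (X k \<omega>))"
    by (rule indep_var_lebesgue_integral[OF ind int1 int2])
  moreover have "expectation (\<lambda>\<omega>. \<Phi> (restrict (\<lambda>i. X i \<omega>) {..<k})) =
      expectation (\<lambda>\<omega>. indicator (inside r k) \<omega> * g (W k \<omega>))"
    by (rule Bochner_Integration.integral_cong[OF refl \<Phi>])
  moreover have "expectation (\<lambda>\<omega>. \<Phi> (restrict (\<lambda>i. X i \<omega>) {..<k}) * f (X k \<omega>)) =
      expectation (\<lambda>\<omega>. indicator (inside r k) \<omega> * g (W k \<omega>) * f (X k \<omega>))"
    by (rule Bochner_Integration.integral_cong[OF refl]) (simp only: \<Phi>)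
  ultimately show ?thesis
    by (simp add: X_def)
qed

text \<open>The addition theorem splits the cosine at the new increment, which is independent of the
  past. The sine product drops out because the increment has mean sine 0, and the mean cosine of the
  increment is the damping factor.\<close>

lemma expectation_inside_cos_Suc:
  assumes k: "k < n"
  shows "expectation (\<lambda>\<omega>. indicator (inside r k) \<omega> * cos (a * W (Suc k) \<omega>))
       = exp (- (a * \<sigma>)\<^sup>2 / 2) * expectation (\<lambda>\<omega>. indicator (inside r k) \<omega> * cos (a * W k \<omega>))"
proof -
  let ?I = "indicator (inside r k) :: 'a \<Rightarrow> real" and ?X = "\<lambda>\<omega>. W (Suc k) \<omega> - W k \<omega>"
  have split: "?I \<omega> * cos (a * W (Suc k) \<omega>) =
      ?I \<omega> * cos (a * W k \<omega>) * cos (a * ?X \<omega>) - ?I \<omega> * sin (a * W k \<omega>) * sin (a * ?X \<omega>)" for \<omega>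
  proof -
    have "a * W (Suc k) \<omega> = a * W k \<omega> + a * ?X \<omega>" by (simp add: algebra_simps)
    then show ?thesis by (simp only: cos_add) (simp add: algebra_simps)
  qed
  have "integrable M (\<lambda>\<omega>. ?I \<omega> * (cos (a * W k \<omega>) * cos (a * ?X \<omega>)))"
    and "integrable M (\<lambda>\<omega>. ?I \<omega> * (sin (a * W k \<omega>) * sin (a * ?X \<omega>)))"
    by (rule integrable_indicator_mult; auto simp: abs_mult intro!: mult_le_one)+
  then have "expectation (\<lambda>\<omega>. ?I \<omega> * cos (a * W (Suc k) \<omega>)) =
      expectation (\<lambda>\<omega>. ?I \<omega> * cos (a * W k \<omega>) * cos (a * ?X \<omega>))
      - expectation (\<lambda>\<omega>. ?I \<omega> * sin (a * W k \<omega>) * sin (a * ?X \<omega>))"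
    unfolding split by (intro Bochner_Integration.integral_diff) (simp_all add: mult.assoc)
  also have "\<dots> = expectation (\<lambda>\<omega>. ?I \<omega> * cos (a * W k \<omega>)) * expectation (\<lambda>\<omega>. cos (a * ?X \<omega>))
      - expectation (\<lambda>\<omega>. ?I \<omega> * sin (a * W k \<omega>)) * expectation (\<lambda>\<omega>. sin (a * ?X \<omega>))"
    using expectation_inside_mult_increment[OF k, of "\<lambda>x. cos (a * x)" "\<lambda>x. cos (a * x)" r]
      expectation_inside_mult_increment[OF k, of "\<lambda>x. sin (a * x)" "\<lambda>x. sin (a * x)" r]
    by simp
  finally show ?thesis
    using normal_expectation_cos_sin[OF sigma_pos increment_normal[OF k], of a] by simp
qed

lemma expectation_inside_cos_split:
  "expectation (\<lambda>\<omega>. indicator (inside r k) \<omega> * cos (a * W (Suc k) \<omega>)) =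
   expectation (\<lambda>\<omega>. indicator (inside r (Suc k)) \<omega> * cos (a * W (Suc k) \<omega>)) +
   expectation (\<lambda>\<omega>. indicator (inside r k - inside r (Suc k)) \<omega> * cos (a * W (Suc k) \<omega>))"
proof (subst Bochner_Integration.integral_add[symmetric])
  show "expectation (\<lambda>\<omega>. indicator (inside r k) \<omega> * cos (a * W (Suc k) \<omega>)) =
    expectation (\<lambda>\<omega>. indicator (inside r (Suc k)) \<omega> * cos (a * W (Suc k) \<omega>) +
      indicator (inside r k - inside r (Suc k)) \<omega> * cos (a * W (Suc k) \<omega>))"
    by (intro Bochner_Integration.integral_cong) (auto simp: indicator_def inside_Suc)
qed (auto intro!: integrable_indicator_mult)

lemma expectation_inside_0:
  assumes "0 < r"
  shows "expectation (\<lambda>\<omega>. indicator (inside r 0) \<omega> * cos (a * W 0 \<omega>)) = 1"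
proof -
  have "expectation (\<lambda>\<omega>. indicator (inside r 0) \<omega> * cos (a * W 0 \<omega>)) = expectation (\<lambda>_. 1)"
    using assms by (intro Bochner_Integration.integral_cong) (auto simp: inside_def W_start)
  then show ?thesis by (simp add: prob_space)
qed

text \<open>With \<open>a = pi / (2 * r)\<close> the cosine is nonpositive for r \<le> |x| \<le> 3r.
  A walk leaving the interval lands there unless its last increment is at least
  \<open>2 * r\<close>, so discarding the exits lowers the cosine expectation by at most
  \<open>e\<close> per step. Since cosine is at most 1, that expectation is itself a lower bound for
  the probability.\<close>

lemma prob_inside_ge:
  assumes r: "0 < r"
  shows "prob (inside r n) \<ge> exp (- real n * (pi / (2 * r) * \<sigma>)\<^sup>2 / 2) - real n * (3 * \<sigma> ^ 4 / (2 * r) ^ 4)"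
proof -
  define a where "a = pi / (2 * r)"
  define m where "m k = expectation (\<lambda>\<omega>. indicator (inside r k) \<omega> * cos (a * W k \<omega>))" for k
  define e where "e = 3 * \<sigma> ^ 4 / (2 * r) ^ 4"
  define q where "q = exp (- (a * \<sigma>)\<^sup>2 / 2)"
  have q: "0 < q" "q \<le> 1" by (auto simp: q_def)
  have e: "0 \<le> e" using r by (auto simp: e_def)
  have ar: "a * r = pi / 2" "0 < a" using r by (auto simp: a_def)
  have step: "m (Suc k) \<ge> q * m k - e" if k: "k < n" for k
  proof -
    let ?X = "\<lambda>\<omega>. W (Suc k) \<omega> - W k \<omega>"
    have "expectation (\<lambda>\<omega>. indicator (inside r k - inside r (Suc k)) \<omega> * cos (a * W (Suc k) \<omega>))
        \<le> expectation (indicator {\<omega>\<in>space M. 2 * r \<le> \<bar>?X \<omega>\<bar>})"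
    proof (rule integral_mono)
      show "integrable M (\<lambda>\<omega>. indicator (inside r k - inside r (Suc k)) \<omega> * cos (a * W (Suc k) \<omega>))"
        by (rule integrable_indicator_mult) auto
      fix \<omega> assume \<omega>: "\<omega> \<in> space M"
      show "indicator (inside r k - inside r (Suc k)) \<omega> * cos (a * W (Suc k) \<omega>)
          \<le> indicator {\<omega>\<in>space M. 2 * r \<le> \<bar>?X \<omega>\<bar>} \<omega>"
      proof (cases "\<omega> \<in> inside r k - inside r (Suc k) \<and> \<bar>?X \<omega>\<bar> < 2 * r")
        case True
        then have "\<bar>W k \<omega>\<bar> < r" "r \<le> \<bar>W (Suc k) \<omega>\<bar>" "\<bar>W (Suc k) \<omega>\<bar> < 3 * r"
          unfolding inside_Suc using \<omega> by (auto simp: inside_def)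
        then have "a * r \<le> a * \<bar>W (Suc k) \<omega>\<bar>" "a * \<bar>W (Suc k) \<omega>\<bar> \<le> a * (3 * r)"
          using ar(2) by (auto intro!: mult_left_mono)
        then have "pi / 2 \<le> \<bar>a * W (Suc k) \<omega>\<bar>" "\<bar>a * W (Suc k) \<omega>\<bar> \<le> 3 * pi / 2"
          using ar by (simp_all add: abs_mult mult.left_commute[of a 3])
        \<comment> \<open>Shifting by \<open>pi\<close> moves the range [pi/2, 3pi/2] to
          [-pi/2, pi/2] and reverses the sign of the cosine.\<close>
        then have "0 \<le> cos (\<bar>a * W (Suc k) \<omega>\<bar> - pi)"
          by (intro cos_ge_zero) auto
        then have "cos (a * W (Suc k) \<omega>) \<le> 0"
          by simp
        then show ?thesis by (simp add: indicator_def)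
      qed (use \<omega> in \<open>auto simp: indicator_def\<close>)
    qed (auto intro: integrable_event_indicator)
    also have "\<dots> = prob {\<omega>\<in>space M. 2 * r \<le> \<bar>?X \<omega>\<bar>}" by simp
    also have "\<dots> \<le> e"
      unfolding e_def using normal_tail_fourth_moment[OF sigma_pos increment_normal[OF k], of "2 * r"] r by simp
    finally show ?thesis
      using expectation_inside_cos_split[of r k a] expectation_inside_cos_Suc[OF k, of r a]
      by (simp add: m_def q_def)
  qed
  have "k \<le> n \<Longrightarrow> m k \<ge> q ^ k - k * e" for k
  proof (induction k)
    case 0
    then show ?case using expectation_inside_0[OF r, of a] by (simp add: m_def)
  next
    case (Suc k)
    have "q ^ Suc k - q * (k * e) \<le> q * m k"
      using mult_left_mono[OF Suc.IH, of q] Suc.prems q by (simp add: algebra_simps)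
    \<comment> \<open>Earlier errors are only damped by q \<le> 1, so the total error grows at most
      linearly in the number of steps.\<close>
    moreover have "q * (k * e) \<le> k * e"
      using q e by (intro mult_left_le_one_le) auto
    ultimately show ?case
      using step[of k] Suc.prems by (simp add: algebra_simps)
  qed
  then have "q ^ n - n * e \<le> m n" by simp
  also have "m n \<le> expectation (indicator (inside r n))"
    unfolding m_def by (intro integral_mono integrable_indicator_mult integrable_event_indicator) (auto simp: indicator_def)
  also have "\<dots> = prob (inside r n)" by simp
  also have "q ^ n = exp (- real n * (a * \<sigma>)\<^sup>2 / 2)"
    unfolding q_def by (simp flip: exp_of_nat_mult)
  finally show ?thesis by (simp add: e_def a_def)
qed

text \<open>The wider interval leaves a margin \<open>R - r\<close>: a walk leaving
  \<open>(-r, r)\<close> by a smaller jump is still in \<open>(-R, R)\<close>, where the cosine is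
  nonnegative, so discarding the exits raises the expectation by at most \<open>e\<close> per step.
  Inside \<open>(-r, r)\<close> the cosine is at least its value at \<open>r\<close>, which turns
  the bound on the expectation into one on the probability.\<close>

lemma prob_inside_le:
  assumes r: "0 < r" "r < R"
  shows "cos (pi * r / (2 * R)) * prob (inside r n)
       \<le> exp (- real n * (pi / (2 * R) * \<sigma>)\<^sup>2 / 2) + real n * (3 * \<sigma> ^ 4 / (R - r) ^ 4)"
proof -
  define a where "a = pi / (2 * R)"
  define m where "m k = expectation (\<lambda>\<omega>. indicator (inside r k) \<omega> * cos (a * W k \<omega>))" for k
  define e where "e = 3 * \<sigma> ^ 4 / (R - r) ^ 4"
  define q where "q = exp (- (a * \<sigma>)\<^sup>2 / 2)"
  have q: "0 < q" "q \<le> 1" by (auto simp: q_def)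
  have e: "0 \<le> e" using r by (auto simp: e_def)
  have ar: "a * R = pi / 2" "0 < a" using r by (auto simp: a_def)
  have step: "m (Suc k) \<le> q * m k + e" if k: "k < n" for k
  proof -
    let ?X = "\<lambda>\<omega>. W (Suc k) \<omega> - W k \<omega>"
    have "expectation (\<lambda>\<omega>. - indicator {\<omega>\<in>space M. R - r \<le> \<bar>?X \<omega>\<bar>} \<omega>)
        \<le> expectation (\<lambda>\<omega>. indicator (inside r k - inside r (Suc k)) \<omega> * cos (a * W (Suc k) \<omega>))"
    proof (rule integral_mono)
      show "integrable M (\<lambda>\<omega>. indicator (inside r k - inside r (Suc k)) \<omega> * cos (a * W (Suc k) \<omega>))"
        by (rule integrable_indicator_mult) auto
      fix \<omega> assume \<omega>: "\<omega> \<in> space M"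
      show "- indicator {\<omega>\<in>space M. R - r \<le> \<bar>?X \<omega>\<bar>} \<omega>
          \<le> indicator (inside r k - inside r (Suc k)) \<omega> * cos (a * W (Suc k) \<omega>)"
      proof (cases "\<omega> \<in> inside r k - inside r (Suc k) \<and> \<bar>?X \<omega>\<bar> < R - r")
        case True
        then have "\<bar>W k \<omega>\<bar> < r" "\<bar>W (Suc k) \<omega>\<bar> < R"
          unfolding inside_Suc using \<omega> by (auto simp: inside_def)
        then have "a * \<bar>W (Suc k) \<omega>\<bar> \<le> a * R"
          using ar(2) by (auto intro!: mult_left_mono)
        then have "\<bar>a * W (Suc k) \<omega>\<bar> \<le> pi / 2"
          using ar by (auto simp: abs_mult)
        then have "0 \<le> cos (a * W (Suc k) \<omega>)"
          by (intro cos_ge_zero) auto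
        then show ?thesis by (simp add: indicator_def)
      next
        case False
        then show ?thesis
          using \<omega> cos_ge_minus_one[of "a * W (Suc k) \<omega>"] by (auto simp: indicator_def)
      qed
    qed (auto intro!: Bochner_Integration.integrable_minus integrable_event_indicator)
    moreover have "prob {\<omega>\<in>space M. R - r \<le> \<bar>?X \<omega>\<bar>} \<le> e"
      unfolding e_def using normal_tail_fourth_moment[OF sigma_pos increment_normal[OF k], of "R - r"] r by simp
    ultimately show ?thesis
      using expectation_inside_cos_split[of r k a] expectation_inside_cos_Suc[OF k, of r a]
      by (simp add: m_def q_def)
  qed
  have "k \<le> n \<Longrightarrow> m k \<le> q ^ k + k * e" for k
  proof (induction k)
    case 0
    then show ?case using expectation_inside_0[OF r(1), of a] by (simp add: m_def)
  next
    case (Suc k)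
    have "q * m k \<le> q ^ Suc k + q * (k * e)"
      using mult_left_mono[OF Suc.IH, of q] Suc.prems q by (simp add: algebra_simps)
    moreover have "q * (k * e) \<le> k * e"
      using q e by (intro mult_left_le_one_le) auto
    ultimately show ?case
      using step[of k] Suc.prems by (simp add: algebra_simps)
  qed
  then have upper: "m n \<le> q ^ n + n * e" by simp
  have "expectation (\<lambda>\<omega>. cos (a * r) * indicator (inside r n) \<omega>) \<le> m n"
    unfolding m_def
  proof (intro integral_mono integrable_indicator_mult)
    fix \<omega>
    have "cos (a * r) \<le> cos (a * W n \<omega>)" if "\<omega> \<in> inside r n"
    proof -
      have "\<bar>W n \<omega>\<bar> < r" using that by (auto simp: inside_def)
      then have "a * \<bar>W n \<omega>\<bar> \<le> a * r" "a * r \<le> a * R"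
        using ar(2) r by (auto intro!: mult_left_mono)
      then have "cos (a * r) \<le> cos (a * \<bar>W n \<omega>\<bar>)"
        using ar pi_gt_zero by (intro cos_monotone_0_pi_le) (auto simp del: pi_gt_zero)
      then show ?thesis
        using ar cos_abs_real[of "a * W n \<omega>"] by (simp add: abs_mult)
    qed
    then show "cos (a * r) * indicator (inside r n) \<omega> \<le> indicator (inside r n) \<omega> * cos (a * W n \<omega>)"
      by (simp add: indicator_def)
  qed (auto intro: integrable_event_indicator)
  then have "cos (a * r) * prob (inside r n) \<le> m n" by simp
  also note upper
  also have "q ^ n = exp (- real n * (a * \<sigma>)\<^sup>2 / 2)"
    unfolding q_def by (simp flip: exp_of_nat_mult)
  finally show ?thesis by (simp add: e_def a_def)
qed

end

subsection \<open>Confinement of Brownian motion\<close>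

text \<open>Sampling at the multiples of \<open>h\<close> gives increments of variance
  \<open>h\<close>; \<open>n\<close> of them need the \<open>n + 1\<close> time points collected in
  \<open>ts\<close>.\<close>

lemma brownian_motion_gaussian_walk:
  assumes BM: "brownian_motion M Y" and h: "0 < h"
  shows "gaussian_walk M (\<lambda>k. Y (real k * h)) (sqrt h) n"
proof -
  interpret prob_space M using BM by (simp add: brownian_motion_def)
  define ts where "ts = map (\<lambda>i. real i * h) [0..<Suc n]"
  have nth: "ts ! i = real i * h" if "i \<le> n" for i
    using that unfolding ts_def by (subst nth_map) (auto simp del: upt_Suc)
  have len: "length ts = Suc n" by (simp add: ts_def)
  have "sorted_wrt (<) ts"
    unfolding sorted_wrt_iff_nth_less using nth h by (auto simp: len)
  moreover have "\<forall>t\<in>set ts. 0 \<le> t" using h by (auto simp: ts_def)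
  ultimately have "indep_vars (\<lambda>_. borel) (\<lambda>i \<omega>. Y (ts ! Suc i) \<omega> - Y (ts ! i) \<omega>) {..<length ts - 1}"
    using BM unfolding brownian_motion_def by blast
  also have "?this \<longleftrightarrow> indep_vars (\<lambda>_. borel) (\<lambda>i \<omega>. Y (real (Suc i) * h) \<omega> - Y (real i * h) \<omega>) {..<n}"
    by (rule indep_vars_cong) (auto simp: len nth)
  finally have indep: "indep_vars (\<lambda>_. borel) (\<lambda>i \<omega>. Y (real (Suc i) * h) \<omega> - Y (real i * h) \<omega>) {..<n}" .
  have normal: "distributed M lborel (\<lambda>\<omega>. Y (real (Suc i) * h) \<omega> - Y (real i * h) \<omega>)
      (\<lambda>x. ennreal (normal_density 0 (sqrt h) x))" for i
  proof -
    have "0 \<le> real i * h \<and> real i * h < real (Suc i) * h" using h by simp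
    then have "distributed M lborel (\<lambda>\<omega>. Y (real (Suc i) * h) \<omega> - Y (real i * h) \<omega>)
      (\<lambda>x. ennreal (normal_density 0 (sqrt (real (Suc i) * h - real i * h)) x))"
      using BM unfolding brownian_motion_def by blast
    moreover have "real (Suc i) * h - real i * h = h" by (simp add: algebra_simps)
    ultimately show ?thesis by simp
  qed
  show ?thesis
  proof
    show "Y (real k * h) \<in> borel_measurable M" for k
      using BM h by (simp add: brownian_motion_def)
  qed (use BM h indep normal in \<open>auto simp: brownian_motion_def\<close>)
qed

section \<open>Confinement at dyadic times\<close>

definition dyadic_confined :: "'a measure \<Rightarrow> (real \<Rightarrow> 'a \<Rightarrow> real) \<Rightarrow> real \<Rightarrow> real \<Rightarrow> 'a set" where
  "dyadic_confined M Y t r =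
     {\<omega>\<in>space M. \<forall>m::nat. \<forall>j\<le>2 ^ m. \<bar>Y (real j * (t / 2 ^ m)) \<omega>\<bar> < r}"

lemma power4_sqrt: "0 \<le> h \<Longrightarrow> sqrt h ^ 4 = h\<^sup>2"
  using power_mult[of "sqrt h" 2 2] by simp

lemma walk_error_tendsto_0:
  assumes "0 < t"
  shows "(\<lambda>m. real (2 ^ m) * (3 * sqrt (t / 2 ^ m) ^ 4 / D)) \<longlonglongrightarrow> 0"
proof -
  have "(\<lambda>m. real (2 ^ m) * (3 * sqrt (t / 2 ^ m) ^ 4 / D)) = (\<lambda>m. 3 * t\<^sup>2 / D * (1 / 2) ^ m)"
    using assms by (auto simp: power4_sqrt fun_eq_iff power_divide power2_eq_square)
  also have "\<dots> \<longlonglongrightarrow> 3 * t\<^sup>2 / D * 0"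
    by (intro tendsto_intros LIMSEQ_power_zero) auto
  finally show ?thesis by simp
qed

text \<open>The event is a decreasing limit of walk events with \<open>2 ^ m\<close> steps of
  variance \<open>t / 2 ^ m\<close>. Number of steps times variance is always \<open>t\<close>, so
  the exponents in the walk bounds do not depend on \<open>m\<close>, and only the error terms
  change, vanishing in the limit.\<close>

lemma prob_dyadic_confined:
  assumes BM: "brownian_motion M Y" and t: "0 < t" and r: "0 < r"
  shows "exp (- (pi\<^sup>2 * t / (8 * r\<^sup>2))) \<le> measure M (dyadic_confined M Y t r)"
    and "r < R \<Longrightarrow> measure M (dyadic_confined M Y t r)
           \<le> exp (- (pi\<^sup>2 * t / (8 * R\<^sup>2))) / cos (pi * r / (2 * R))"
proof -
  interpret prob_space M using BM by (simp add: brownian_motion_def)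
  define C where "C m = {\<omega>\<in>space M. \<forall>j\<le>2 ^ m. \<bar>Y (real j * (t / 2 ^ m)) \<omega>\<bar> < r}" for m :: nat
  have walk: "gaussian_walk M (\<lambda>k. Y (real k * (t / 2 ^ m))) (sqrt (t / 2 ^ m)) (2 ^ m)" for m
    using t by (intro brownian_motion_gaussian_walk[OF BM]) simp
  have inside: "gaussian_walk.inside M (\<lambda>k. Y (real k * (t / 2 ^ m))) r (2 ^ m) = C m" for m
    using gaussian_walk.inside_def[OF walk] by (auto simp: C_def)
  have C_sets: "C m \<in> events" for m
    using gaussian_walk.inside_sets[OF walk[of m], of r "2 ^ m"] inside by simp
  have B: "dyadic_confined M Y t r = (\<Inter>m. C m)"
    by (auto simp: dyadic_confined_def C_def)
  \<comment> \<open>Time \<open>j\<close> of level \<open>m\<close> is time \<open>2 * j\<close> of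
    level \<open>Suc m\<close>.\<close>
  have "decseq C"
  proof (intro decseq_SucI subsetI)
    fix m \<omega> assume \<omega>: "\<omega> \<in> C (Suc m)"
    have "\<bar>Y (real j * (t / 2 ^ m)) \<omega>\<bar> < r" if "j \<le> 2 ^ m" for j
    proof -
      have "\<bar>Y (real (2 * j) * (t / 2 ^ Suc m)) \<omega>\<bar> < r"
        using \<omega> that unfolding C_def mem_Collect_eq by (metis mult_le_mono2 power_Suc)
      then show ?thesis by simp
    qed
    then show "\<omega> \<in> C m" using \<omega> by (simp add: C_def)
  qed
  then have lim: "(\<lambda>m. prob (C m)) \<longlonglongrightarrow> prob (dyadic_confined M Y t r)"
    unfolding B using C_sets by (intro finite_Lim_measure_decseq) auto
  have exponent: "exp (- real (2 ^ m) * (pi / (2 * \<rho>) * sqrt (t / 2 ^ m))\<^sup>2 / 2) = exp (- (pi\<^sup>2 * t / (8 * \<rho>\<^sup>2)))" for m \<rho>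
    using t by (simp add: power_mult_distrib power_divide)
  have "(\<lambda>m. exp (- (pi\<^sup>2 * t / (8 * r\<^sup>2))) - real (2 ^ m) * (3 * sqrt (t / 2 ^ m) ^ 4 / (2 * r) ^ 4))
      \<longlonglongrightarrow> exp (- (pi\<^sup>2 * t / (8 * r\<^sup>2))) - 0"
    by (intro tendsto_diff tendsto_const walk_error_tendsto_0[OF t])
  moreover have "exp (- (pi\<^sup>2 * t / (8 * r\<^sup>2))) - real (2 ^ m) * (3 * sqrt (t / 2 ^ m) ^ 4 / (2 * r) ^ 4) \<le> prob (C m)" for m
    using gaussian_walk.prob_inside_ge[OF walk[of m] r, unfolded inside exponent] .
  ultimately show "exp (- (pi\<^sup>2 * t / (8 * r\<^sup>2))) \<le> prob (dyadic_confined M Y t r)"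
    using LIMSEQ_le[OF _ lim] by (metis (no_types, lifting) diff_zero)
  assume R: "r < R"
  have "pi * r / (2 * R) < pi / 2"
    using r R by (simp add: field_simps)
  then have cos: "0 < cos (pi * r / (2 * R))"
    using r R by (intro cos_gt_zero_pi) (auto intro: less_trans[of _ 0])
  have "(\<lambda>m. exp (- (pi\<^sup>2 * t / (8 * R\<^sup>2))) + real (2 ^ m) * (3 * sqrt (t / 2 ^ m) ^ 4 / (R - r) ^ 4))
      \<longlonglongrightarrow> exp (- (pi\<^sup>2 * t / (8 * R\<^sup>2))) + 0"
    by (intro tendsto_add tendsto_const walk_error_tendsto_0[OF t])
  moreover have "cos (pi * r / (2 * R)) * prob (C m) \<le>
      exp (- (pi\<^sup>2 * t / (8 * R\<^sup>2))) + real (2 ^ m) * (3 * sqrt (t / 2 ^ m) ^ 4 / (R - r) ^ 4)" for m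
    using gaussian_walk.prob_inside_le[OF walk[of m] r R, unfolded inside exponent] .
  moreover have "(\<lambda>m. cos (pi * r / (2 * R)) * prob (C m)) \<longlonglongrightarrow>
      cos (pi * r / (2 * R)) * prob (dyadic_confined M Y t r)"
    by (intro tendsto_mult tendsto_const lim)
  ultimately have "cos (pi * r / (2 * R)) * prob (dyadic_confined M Y t r) \<le> exp (- (pi\<^sup>2 * t / (8 * R\<^sup>2))) + 0"
    by (blast intro: LIMSEQ_le)
  then show "prob (dyadic_confined M Y t r) \<le> exp (- (pi\<^sup>2 * t / (8 * R\<^sup>2))) / cos (pi * r / (2 * R))"
    using cos by (simp add: field_simps)
qed

text \<open>Rounding \<open>s\<close> down to the grid of level \<open>m\<close> gives a point at
  distance at most \<open>t / 2 ^ m\<close>; continuity carries the bound to the limit. Only a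
  non-strict bound survives, so later uses have to recover strictness separately.\<close>

lemma le_on_dyadics_imp_le:
  fixes f :: "real \<Rightarrow> real"
  assumes cont: "continuous_on {0..t} f" and t: "0 < t"
    and le: "\<And>m j. j \<le> (2::nat) ^ m \<Longrightarrow> f (real j * (t / 2 ^ m)) \<le> b"
    and s: "s \<in> {0..t}"
  shows "f s \<le> b"
proof -
  define j where "j m = nat \<lfloor>2 ^ m * (s / t)\<rfloor>" for m :: nat
  define x where "x m = real (j m) * (t / 2 ^ m)" for m
  have st: "0 \<le> s / t" "s / t \<le> 1" using s t by auto
  have rj: "real (j m) = of_int \<lfloor>2 ^ m * (s / t)\<rfloor>" for m
    using st mult_nonneg_nonneg[of "2 ^ m" "s / t"] unfolding j_def
    by (intro of_nat_nat) (simp only: zero_le_floor zero_le_power zero_le_numeral)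
  have j_upper: "real (j m) \<le> 2 ^ m * (s / t)" for m
    unfolding rj by (rule of_int_floor_le)
  have j_lower: "2 ^ m * (s / t) \<le> real (j m) + 1" for m
    unfolding rj by linarith
  have "real (j m) \<le> 2 ^ m" for m
    by (rule order_trans[OF j_upper]) (use mult_left_mono[OF st(2), of "2 ^ m"] in simp)
  then have j_le: "j m \<le> 2 ^ m" for m
    by (metis of_nat_le_iff of_nat_numeral of_nat_power)
  have x_upper: "x m \<le> s" for m
    using j_upper[of m] t by (simp add: x_def field_simps)
  have x_lower: "s - t * (1 / 2) ^ m \<le> x m" for m
    using mult_right_mono[OF j_lower[of m], of "t / 2 ^ m"] t
    by (simp add: x_def power_divide distrib_right add_divide_distrib)
  have "x \<longlonglongrightarrow> s"
  proof (rule tendsto_sandwich[where h="\<lambda>_. s"])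
    have "(\<lambda>m. s - t * (1 / 2) ^ m) \<longlonglongrightarrow> s - t * 0"
      by (intro tendsto_intros LIMSEQ_power_zero) auto
    then show "(\<lambda>m. s - t * (1 / 2) ^ m) \<longlonglongrightarrow> s" by simp
  qed (use x_upper x_lower in auto)
  moreover have "x m \<in> {0..t}" for m
    using x_upper[of m] s t by (auto simp: x_def)
  ultimately have "(\<lambda>m. f (x m)) \<longlonglongrightarrow> f s"
    using s by (intro continuous_on_tendsto_compose[OF cont]) auto
  then show ?thesis
    using le[OF j_le] by (intro LIMSEQ_le_const2) (auto simp: x_def)
qed

section \<open>Confinement at all times and the exit time\<close>

definition confined :: "'a measure \<Rightarrow> (real \<Rightarrow> 'a \<Rightarrow> real) \<Rightarrow> ('a \<Rightarrow> real) \<Rightarrow> real \<Rightarrow> 'a set" where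
  "confined M Y \<xi> t = {\<omega>\<in>space M. \<forall>s\<in>{0..t}. \<bar>Y s \<omega>\<bar> < \<xi> \<omega>}"

lemma brownian_motion_continuous:
  assumes "brownian_motion M Y" "\<omega> \<in> space M"
  shows "continuous_on {0..} (\<lambda>t. Y t \<omega>)"
  using assms by (simp add: brownian_motion_def)

text \<open>On a compact time interval a continuous path attains its maximal modulus, so a confined
  path keeps some gap \<open>inverse (Suc k)\<close> from \<xi>. With this gap the bound passes from
  dyadic times to all times and stays strict, which leaves only countably many conditions.\<close>

lemma confined_sets:
  assumes BM: "brownian_motion M Y" and [measurable]: "\<xi> \<in> borel_measurable M" and t: "0 < t"
  shows "confined M Y \<xi> t \<in> sets M"
proof -
  have [measurable]: "Y (real j * (t / 2 ^ m)) \<in> borel_measurable M" for j m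
    using BM t by (simp add: brownian_motion_def)
  have "confined M Y \<xi> t =
    {\<omega>\<in>space M. \<exists>k::nat. \<forall>m::nat. \<forall>j\<le>2 ^ m. \<bar>Y (real j * (t / 2 ^ m)) \<omega>\<bar> \<le> \<xi> \<omega> - inverse (Suc k)}"
    (is "_ = ?rhs")
  proof (intro equalityI subsetI)
    fix \<omega> assume \<omega>: "\<omega> \<in> confined M Y \<xi> t"
    then have sp: "\<omega> \<in> space M" by (simp add: confined_def)
    have "continuous_on {0..t} (\<lambda>s. \<bar>Y s \<omega>\<bar>)"
      by (intro continuous_intros continuous_on_subset[OF brownian_motion_continuous[OF BM sp]]) auto
    then obtain x where x: "x \<in> {0..t}" "\<forall>s\<in>{0..t}. \<bar>Y s \<omega>\<bar> \<le> \<bar>Y x \<omega>\<bar>"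
      using continuous_attains_sup[of "{0..t}" "\<lambda>s. \<bar>Y s \<omega>\<bar>"] t by auto
    have "0 < \<xi> \<omega> - \<bar>Y x \<omega>\<bar>" using \<omega> x(1) by (auto simp: confined_def)
    then obtain k where k: "inverse (real (Suc k)) < \<xi> \<omega> - \<bar>Y x \<omega>\<bar>"
      using reals_Archimedean by blast
    have "\<bar>Y (real j * (t / 2 ^ m)) \<omega>\<bar> \<le> \<xi> \<omega> - inverse (Suc k)" if "j \<le> 2 ^ m" for m j
    proof -
      have "real j \<le> 2 ^ m" using that by (metis of_nat_le_iff of_nat_numeral of_nat_power)
      then have "real j * (t / 2 ^ m) \<in> {0..t}" using t by (auto simp: field_simps)
      then show ?thesis using x(2) k by fastforce
    qed
    then show "\<omega> \<in> ?rhs" using sp by auto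
  next
    fix \<omega> assume "\<omega> \<in> ?rhs"
    then obtain k where sp: "\<omega> \<in> space M"
      and k: "\<And>m j. j \<le> 2 ^ m \<Longrightarrow> \<bar>Y (real j * (t / 2 ^ m)) \<omega>\<bar> \<le> \<xi> \<omega> - inverse (Suc k)"
      by auto
    have "continuous_on {0..t} (\<lambda>s. \<bar>Y s \<omega>\<bar>)"
      by (intro continuous_intros continuous_on_subset[OF brownian_motion_continuous[OF BM sp]]) auto
    from le_on_dyadics_imp_le[OF this t k]
    have "\<bar>Y s \<omega>\<bar> \<le> \<xi> \<omega> - inverse (Suc k)" if "s \<in> {0..t}" for s using that by blast
    moreover have "0 < inverse (real (Suc k))" by simp
    ultimately have "\<bar>Y s \<omega>\<bar> < \<xi> \<omega>" if "s \<in> {0..t}" for s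
      using that by (meson diff_less_eq less_add_same_cancel1 order_le_less_trans)
    then show "\<omega> \<in> confined M Y \<xi> t"
      using sp by (simp add: confined_def)
  qed
  also have "\<dots> \<in> sets M" by measurable
  finally show ?thesis .
qed

text \<open>On paths that never exit, \<^const>\<open>exit_time\<close> takes the unspecified value \<open>Inf {}\<close>.\<close>

lemma exit_time_greater_eq:
  fixes M :: "'a measure" and \<xi> :: "'a \<Rightarrow> real"
  assumes BM: "brownian_motion M Y" and t: "0 < t"
  defines "N \<equiv> (\<Inter>n. confined M Y \<xi> (real (Suc n)))"
  shows "{\<omega>\<in>space M. exit_time Y \<xi> \<omega> > t} =
    (confined M Y \<xi> t - N) \<union> (if t < Inf ({}::real set) then N else {})"
proof -
  have N: "\<omega> \<in> N \<longleftrightarrow> (\<forall>s\<ge>0. \<bar>Y s \<omega>\<bar> < \<xi> \<omega>)" if "\<omega> \<in> space M" for \<omega>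
  proof
    assume \<omega>: "\<omega> \<in> N"
    show "\<forall>s\<ge>0. \<bar>Y s \<omega>\<bar> < \<xi> \<omega>"
    proof (intro allI impI)
      fix s :: real assume "0 \<le> s"
      moreover obtain n where "s \<le> real n" using real_arch_simple by blast
      ultimately have "s \<in> {0..real (Suc n)}" by simp
      moreover have "\<omega> \<in> confined M Y \<xi> (real (Suc n))" using \<omega> unfolding N_def by blast
      ultimately show "\<bar>Y s \<omega>\<bar> < \<xi> \<omega>" by (simp add: confined_def)
    qed
  qed (use that in \<open>auto simp: N_def confined_def\<close>)
  have N_sub: "N \<subseteq> space M" by (auto simp: N_def confined_def)
  have "exit_time Y \<xi> \<omega> > t \<longleftrightarrow> \<omega> \<in> confined M Y \<xi> t" if \<omega>: "\<omega> \<in> space M" "\<omega> \<notin> N" for \<omega>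
  proof -
    define E where "E = {s. 0 \<le> s \<and> Y s \<omega> \<notin> {- \<xi> \<omega> <..< \<xi> \<omega>}}"
    have E: "s \<in> E \<longleftrightarrow> 0 \<le> s \<and> \<not> \<bar>Y s \<omega>\<bar> < \<xi> \<omega>" for s
      by (auto simp: E_def abs_less_iff)
    have "E \<noteq> {}" using N[OF \<omega>(1)] \<omega>(2) E by auto
    moreover have bdd: "bdd_below E" by (rule bdd_belowI[of _ 0]) (auto simp: E_def)
    moreover have "E = {0..} \<inter> (\<lambda>s. Y s \<omega>) -` (- {- \<xi> \<omega> <..< \<xi> \<omega>})" by (auto simp: E_def)
    then have "closed E"
      using continuous_closed_preimage[OF brownian_motion_continuous[OF BM \<omega>(1)], of "- {- \<xi> \<omega> <..< \<xi> \<omega>}"]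
      by (simp add: closed_Compl)
    \<comment> \<open>The infimum is attained because \<open>E\<close> is closed, so exceeding
      \<open>t\<close> means confinement up to and including time \<open>t\<close>.\<close>
    ultimately have Inf: "Inf E \<in> E" by (rule closed_contains_Inf)
    have "exit_time Y \<xi> \<omega> = Inf E" by (simp add: exit_time_def E_def)
    moreover have "t < Inf E \<longleftrightarrow> (\<forall>s\<in>{0..t}. \<bar>Y s \<omega>\<bar> < \<xi> \<omega>)"
    proof
      assume "t < Inf E"
      then have "s \<notin> E" if "s \<in> {0..t}" for s
        using cInf_lower[OF _ bdd, of s] that by auto
      then show "\<forall>s\<in>{0..t}. \<bar>Y s \<omega>\<bar> < \<xi> \<omega>" using E by auto
    next
      assume "\<forall>s\<in>{0..t}. \<bar>Y s \<omega>\<bar> < \<xi> \<omega>"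
      then show "t < Inf E" using Inf E by (meson atLeastAtMost_iff not_less)
    qed
    ultimately show ?thesis using \<omega>(1) by (simp add: confined_def)
  qed
  moreover have "exit_time Y \<xi> \<omega> = Inf {}" if \<omega>: "\<omega> \<in> N" for \<omega>
  proof -
    have "\<bar>Y s \<omega>\<bar> < \<xi> \<omega>" if "0 \<le> s" for s
      using N N_sub \<omega> that by blast
    then have "{s. 0 \<le> s \<and> Y s \<omega> \<notin> {- \<xi> \<omega> <..< \<xi> \<omega>}} = {}"
      by (force simp: abs_less_iff)
    then show ?thesis by (simp only: exit_time_def)
  qed
  moreover have "confined M Y \<xi> t \<subseteq> space M" by (auto simp: confined_def)
  ultimately have "\<omega> \<in> {\<omega>\<in>space M. exit_time Y \<xi> \<omega> > t} \<longleftrightarrow>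
      \<omega> \<in> (confined M Y \<xi> t - N) \<union> (if t < Inf ({}::real set) then N else {})" for \<omega>
    using N_sub by (cases "\<omega> \<in> N"; force)
  then show ?thesis by (rule set_eqI)
qed

text \<open>The paths that never exit lie in every confinement event, so they form a null set once
  these probabilities tend to 0. The value of \<open>Inf {}\<close> then has no influence on the
  probability.\<close>

lemma prob_exit_time_greater:
  assumes BM: "brownian_motion M Y" and \<xi>: "\<xi> \<in> borel_measurable M" and t: "0 < t"
    and lim: "((\<lambda>t. measure M (confined M Y \<xi> t)) \<longlongrightarrow> 0) at_top"
  shows "measure M {\<omega>\<in>space M. exit_time Y \<xi> \<omega> > t} = measure M (confined M Y \<xi> t)"
proof -
  interpret prob_space M using BM by (simp add: brownian_motion_def)
  define N where "N = (\<Inter>n. confined M Y \<xi> (real (Suc n)))"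
  have ev: "confined M Y \<xi> t \<in> events" if "0 < t" for t
    by (rule confined_sets[OF BM \<xi> that])
  have N_ev: "N \<in> events" unfolding N_def using ev by (intro sets.countable_INT) auto
  have "prob N \<le> prob (confined M Y \<xi> (real (Suc n)))" for n
    using ev by (intro finite_measure_mono) (auto simp: N_def)
  moreover have "(\<lambda>n. prob (confined M Y \<xi> (real (Suc n)))) \<longlonglongrightarrow> 0"
    by (rule filterlim_compose[OF lim])
       (rule filterlim_compose[OF filterlim_real_sequentially filterlim_Suc])
  ultimately have "prob N \<le> 0"
    by (intro LIMSEQ_le_const) auto
  then have N0: "prob N = 0" by (simp add: measure_le_0_iff)
  then have null: "N \<in> null_sets M" using N_ev by (simp add: emeasure_eq_measure null_setsI)
  have "prob (confined M Y \<xi> t - N) = prob (confined M Y \<xi> t)"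
    using ev[OF t] null by (rule measure_Diff_null_set[symmetric, THEN sym])
  then show ?thesis
    using measure_Un_null_set[OF _ null, of "confined M Y \<xi> t - N"] ev[OF t] N_ev
    unfolding exit_time_greater_eq[OF BM t] N_def[symmetric] by auto
qed

section \<open>Combining confinement with an independent random radius\<close>

lemma dyadic_confined_in_path_algebra:
  assumes "0 < t"
  shows "dyadic_confined M Y t r \<in> sets (vimage_algebra (space M)
    (\<lambda>\<omega>. restrict (\<lambda>t. Y t \<omega>) {0..}) (Pi\<^sub>M {0..} (\<lambda>_. borel)))"
proof -
  let ?P = "Pi\<^sub>M {0::real..} (\<lambda>_. borel :: real measure)"
  define S where "S = {f\<in>space ?P. \<forall>m::nat. \<forall>j\<le>2 ^ m. \<bar>f (real j * (t / 2 ^ m))\<bar> < r}"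
  have [measurable]: "(\<lambda>f. f (real j * (t / 2 ^ m))) \<in> borel_measurable ?P" for j m :: nat
    using assms by (intro measurable_component_singleton) simp
  have "S \<in> sets ?P" unfolding S_def by measurable
  \<comment> \<open>Only countably many coordinates of the path, all at nonnegative times, enter the
    event. It is thus a preimage under the path map and open to the independence assumption.\<close>
  moreover have "dyadic_confined M Y t r = (\<lambda>\<omega>. restrict (\<lambda>t. Y t \<omega>) {0..}) -` S \<inter> space M"
    using assms by (auto simp: dyadic_confined_def S_def space_PiM)
  ultimately show ?thesis
    by (simp add: in_vimage_algebra)
qed

text \<open>Confinement is guaranteed if \<xi> exceeds \<open>r\<close> and the path stays within
  radius \<open>r\<close>; these two events are independent.\<close>

lemma prob_confined_ge:
  assumes BM: "brownian_motion M Y" and \<xi>: "\<xi> \<in> borel_measurable M"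
    and indep: "prob_space.indep_set M (sets (vimage_algebra (space M) \<xi> borel))
                  (sets (vimage_algebra (space M) (\<lambda>\<omega>. restrict (\<lambda>t. Y t \<omega>) {0..})
                     (Pi\<^sub>M {0..} (\<lambda>_. borel))))"
    and t: "0 < t" and r: "0 < r"
  shows "measure M {\<omega>\<in>space M. \<xi> \<omega> > r} * exp (- (pi\<^sup>2 * t / (8 * r\<^sup>2))) \<le> measure M (confined M Y \<xi> t)"
proof -
  interpret prob_space M using BM by (simp add: brownian_motion_def)
  let ?T = "{\<omega>\<in>space M. \<xi> \<omega> > r}" and ?B = "dyadic_confined M Y t r"
  have T: "?T \<in> sets (vimage_algebra (space M) \<xi> borel)"
    using in_vimage_algebra[of "{r<..}" borel \<xi> "space M"]
    by (auto simp: vimage_def Int_def conj_commute)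
  have "prob ?T * exp (- (pi\<^sup>2 * t / (8 * r\<^sup>2))) \<le> prob ?T * prob ?B"
    by (intro mult_left_mono prob_dyadic_confined[OF BM t r]) auto
  also have "\<dots> = prob (?T \<inter> ?B)"
    using indep_setD[OF indep T dyadic_confined_in_path_algebra[OF t]] by simp
  also have "\<dots> \<le> prob (confined M Y \<xi> t)"
  proof (rule finite_measure_mono[OF _ confined_sets[OF BM \<xi> t]], rule subsetI)
    fix \<omega> assume \<omega>: "\<omega> \<in> ?T \<inter> ?B"
    then have sp: "\<omega> \<in> space M" by simp
    have "continuous_on {0..t} (\<lambda>s. \<bar>Y s \<omega>\<bar>)"
      by (intro continuous_intros continuous_on_subset[OF brownian_motion_continuous[OF BM sp]]) auto
    moreover have "\<bar>Y (real j * (t / 2 ^ m)) \<omega>\<bar> \<le> r" if "j \<le> 2 ^ m" for j m :: nat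
      using \<omega> that by (auto simp: dyadic_confined_def intro: less_imp_le)
    \<comment> \<open>Continuity weakens the dyadic bound to a non-strict one; \<xi> > r restores
      strictness.\<close>
    ultimately have "\<bar>Y s \<omega>\<bar> \<le> r" if "s \<in> {0..t}" for s
      using le_on_dyadics_imp_le[OF _ t _ that] by blast
    then show "\<omega> \<in> confined M Y \<xi> t" using \<omega> by (fastforce simp: confined_def)
  qed
  finally show ?thesis .
qed

text \<open>The event is split according to the position of \<xi> relative to the points
  \<open>x k\<close>. Below \<open>x 0\<close> only the confinement is kept, between
  \<open>x k\<close> and \<open>x (Suc k)\<close> independence gives a product of tail and
  confinement, and above \<open>x N\<close> the confinement is dropped.\<close>

lemma prob_confined_le:
  assumes BM: "brownian_motion M Y" and \<xi>[measurable]: "\<xi> \<in> borel_measurable M"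
    and indep: "prob_space.indep_set M (sets (vimage_algebra (space M) \<xi> borel))
                  (sets (vimage_algebra (space M) (\<lambda>\<omega>. restrict (\<lambda>t. Y t \<omega>) {0..})
                     (Pi\<^sub>M {0..} (\<lambda>_. borel))))"
    and t: "0 < t" and q: "1 < q" and x: "\<And>k. 0 < x k"
  shows "cos (pi / (2 * q)) * measure M (confined M Y \<xi> t) \<le>
    exp (- (pi\<^sup>2 * t / (8 * (q * x 0)\<^sup>2)))
    + (\<Sum>k<N. measure M {\<omega>\<in>space M. \<xi> \<omega> > x k} * exp (- (pi\<^sup>2 * t / (8 * (q * x (Suc k))\<^sup>2))))
    + measure M {\<omega>\<in>space M. \<xi> \<omega> > x N}"
proof -
  interpret prob_space M using BM by (simp add: brownian_motion_def)
  define T where "T r = {\<omega>\<in>space M. \<xi> \<omega> > r}" for r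
  define B where "B r = dyadic_confined M Y t r" for r
  define A where "A = confined M Y \<xi> t"
  define E where "E r = exp (- (pi\<^sup>2 * t / (8 * (q * r)\<^sup>2)))" for r
  define C where "C = cos (pi / (2 * q))"
  have "pi / (2 * q) < pi / 2" using q by (simp add: field_simps)
  then have C: "0 < C" "C \<le> 1"
    unfolding C_def using q by (auto intro!: cos_gt_zero_pi intro: less_trans[of _ 0])
  have T_vimage: "T r \<in> sets (vimage_algebra (space M) \<xi> borel)" for r
    using in_vimage_algebra[of "{r<..}" borel \<xi> "space M"]
    by (auto simp: T_def vimage_def Int_def conj_commute)
  have B_vimage: "B r \<in> sets (vimage_algebra (space M) (\<lambda>\<omega>. restrict (\<lambda>t. Y t \<omega>) {0..})
                     (Pi\<^sub>M {0..} (\<lambda>_. borel)))" for r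
    unfolding B_def by (rule dyadic_confined_in_path_algebra[OF t])
  have T_ev [measurable]: "T r \<in> events" for r
    using T_vimage indep_setD_ev1[OF indep] by blast
  have B_ev [measurable]: "B r \<in> events" for r
    using B_vimage indep_setD_ev2[OF indep] by blast
  have A_ev [measurable]: "A \<in> events"
    unfolding A_def by (rule confined_sets[OF BM \<xi> t])
  have prod: "prob (T u \<inter> B v) = prob (T u) * prob (B v)" for u v
    using indep_setD[OF indep T_vimage B_vimage] .
  have CB: "C * prob (B r) \<le> E r" if "0 < r" for r
  proof -
    \<comment> \<open>Taking the wider radius as \<open>q * r\<close> gives the same cosine factor
      \<open>C\<close> for every \<open>r\<close>, so a single \<open>C\<close> serves all
      terms.\<close>
    have "pi * r / (2 * (q * r)) = pi / (2 * q)" using that by simp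
    then show ?thesis
      using prob_dyadic_confined(2)[OF BM t that, of "q * r"] that q C
      by (simp add: B_def C_def E_def field_simps)
  qed
  have AB: "A - T v \<subseteq> B v" for v
  proof
    fix \<omega> assume \<omega>: "\<omega> \<in> A - T v"
    have "\<bar>Y (real j * (t / 2 ^ m)) \<omega>\<bar> < v" if "j \<le> 2 ^ m" for m j :: nat
    proof -
      have "real j \<le> 2 ^ m" using that by (metis of_nat_le_iff of_nat_numeral of_nat_power)
      then have "real j * (t / 2 ^ m) \<in> {0..t}" using t by (auto simp: field_simps)
      then have "\<bar>Y (real j * (t / 2 ^ m)) \<omega>\<bar> < \<xi> \<omega>" "\<xi> \<omega> \<le> v"
        using \<omega> by (auto simp: A_def T_def confined_def)
      then show ?thesis by simp
    qed
    then show "\<omega> \<in> B v" using \<omega> by (auto simp: A_def B_def confined_def dyadic_confined_def)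
  qed
  have main: "C * prob (A - T (x n)) \<le> E (x 0) + (\<Sum>k<n. prob (T (x k)) * E (x (Suc k)))" for n
  proof (induction n)
    case 0
    have "C * prob (A - T (x 0)) \<le> C * prob (B (x 0))"
      using C AB by (intro mult_left_mono finite_measure_mono) auto
    then show ?case using CB[OF x, of 0] by simp
  next
    case (Suc n)
    have "A - T (x (Suc n)) \<subseteq> (A - T (x n)) \<union> (T (x n) \<inter> B (x (Suc n)))"
      using AB by blast
    then have "prob (A - T (x (Suc n))) \<le> prob ((A - T (x n)) \<union> (T (x n) \<inter> B (x (Suc n))))"
      by (intro finite_measure_mono) auto
    also have "\<dots> \<le> prob (A - T (x n)) + prob (T (x n) \<inter> B (x (Suc n)))"
      by (intro measure_Un_le) auto
    finally have "C * prob (A - T (x (Suc n))) \<le> C * (prob (A - T (x n)) + prob (T (x n) \<inter> B (x (Suc n))))"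
      using C by (intro mult_left_mono) auto
    also have "\<dots> = C * prob (A - T (x n)) + prob (T (x n)) * (C * prob (B (x (Suc n))))"
      by (simp add: prod algebra_simps)
    also have "\<dots> \<le> E (x 0) + (\<Sum>k<n. prob (T (x k)) * E (x (Suc k))) + prob (T (x n)) * E (x (Suc n))"
      by (intro add_mono Suc.IH mult_left_mono CB[OF x]) auto
    finally show ?case by simp
  qed
  have "prob A \<le> prob ((A - T (x N)) \<union> T (x N))"
    by (intro finite_measure_mono) auto
  also have "\<dots> \<le> prob (A - T (x N)) + prob (T (x N))"
    by (intro measure_Un_le) auto
  finally have "C * prob A \<le> C * (prob (A - T (x N)) + prob (T (x N)))"
    using C by (intro mult_left_mono) auto
  also have "\<dots> \<le> C * prob (A - T (x N)) + prob (T (x N))"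
    using C mult_left_le_one_le[of "prob (T (x N))" C] by (simp add: distrib_left)
  finally show ?thesis
    using main[of N] by (simp add: A_def C_def E_def T_def)
qed

subsection \<open>Laplace asymptotics\<close>

text \<open>The minimum of c \<rho>^\<beta> + pi^2 / (8 \<rho>^2) over \<rho> > 0, in the closed
  form of the theorem; \<open>rate_constant_attained\<close> and \<open>rate_constant_le\<close>
  prove this.\<close>

definition rate_constant :: "real \<Rightarrow> real \<Rightarrow> real" where
  "rate_constant \<beta> c = 2 powr (- 2 * \<beta> / (2 + \<beta>)) * ((2 + \<beta>) / 2) * c powr (2 / (2 + \<beta>))
     * \<beta> powr (- \<beta> / (2 + \<beta>)) * pi powr (2 * \<beta> / (2 + \<beta>))"

text \<open>The critical point of c \<rho>^\<beta> + pi^2 / (8 \<rho>^2): the derivative vanishes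
  when \<rho>^(2 + \<beta>) = pi^2 / (4 c \<beta>).\<close>

definition optimal_radius :: "real \<Rightarrow> real \<Rightarrow> real" where
  "optimal_radius \<beta> c = (pi\<^sup>2 / (4 * c * \<beta>)) powr (1 / (2 + \<beta>))"

context
  fixes \<beta> c :: real
  assumes beta: "\<beta> > 0" and c: "c > 0"
begin

lemma optimal_radius_pos: "0 < optimal_radius \<beta> c"
  using beta c by (simp add: optimal_radius_def)

lemma rate_constant_pos: "0 < rate_constant \<beta> c"
  using beta c by (simp add: rate_constant_def)

lemma rate_constant_eq: "rate_constant \<beta> c = c * optimal_radius \<beta> c powr \<beta> * ((2 + \<beta>) / 2)"
proof -
  \<comment> \<open>In terms of \<open>p\<close> all exponents of the closed form become linear:
    \<open>1 - p\<close>, \<open>- p\<close> and plus or minus \<open>2 * p\<close>.\<close>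
  define p where "p = \<beta> / (2 + \<beta>)"
  have p: "2 / (2 + \<beta>) = 1 - p" "- \<beta> / (2 + \<beta>) = - p" "- 2 * \<beta> / (2 + \<beta>) = - (2 * p)" "2 * \<beta> / (2 + \<beta>) = 2 * p"
    using beta by (auto simp: p_def field_simps)
  have "optimal_radius \<beta> c powr \<beta> = (pi\<^sup>2 / (4 * c * \<beta>)) powr p"
    by (simp add: optimal_radius_def powr_powr p_def)
  also have "\<dots> = (pi powr 2 / (2 powr 2 * c * \<beta>)) powr p" by simp
  also have "\<dots> = pi powr (2 * p) / (2 powr (2 * p) * c powr p * \<beta> powr p)"
    using beta c by (simp only: powr_divide powr_mult powr_powr)
  finally have "c * optimal_radius \<beta> c powr \<beta> = c powr 1 * pi powr (2 * p) / (2 powr (2 * p) * c powr p * \<beta> powr p)"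
    using c by simp
  also have "\<dots> = 2 powr (- (2 * p)) * c powr (1 - p) * \<beta> powr (- p) * pi powr (2 * p)"
    by (simp add: powr_minus powr_diff field_simps del: powr_one)
  finally show ?thesis
    unfolding rate_constant_def p by simp
qed

text \<open>The critical point equation, read as a fixed ratio \<beta> / 2 between confinement cost
  and tail cost.\<close>

lemma optimal_radius_balance:
  "pi\<^sup>2 / (8 * (optimal_radius \<beta> c)\<^sup>2) = \<beta> / 2 * (c * optimal_radius \<beta> c powr \<beta>)"
proof -
  let ?\<rho> = "optimal_radius \<beta> c"
  have "?\<rho> powr \<beta> * ?\<rho> powr 2 = ?\<rho> powr (2 + \<beta>)"
    by (simp add: powr_add mult.commute)
  also have "\<dots> = pi\<^sup>2 / (4 * c * \<beta>)"
    using beta c by (simp add: optimal_radius_def powr_powr)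
  finally have "?\<rho> powr \<beta> * ?\<rho>\<^sup>2 = pi\<^sup>2 / (4 * c * \<beta>)"
    using optimal_radius_pos by simp
  then show ?thesis
    using optimal_radius_pos beta c by (simp add: field_simps)
qed

lemma rate_constant_attained:
  "c * optimal_radius \<beta> c powr \<beta> + pi\<^sup>2 / (8 * (optimal_radius \<beta> c)\<^sup>2) = rate_constant \<beta> c"
  unfolding optimal_radius_balance rate_constant_eq by (simp add: field_simps)

text \<open>Dividing by the tail cost at the optimal radius and writing
  \<open>\<rho> = \<rho>' * u\<close> reduces the claim to 1 + \<beta>/2 \<le> u^\<beta> +
  (\<beta>/2) u^(-2). This is the sum of u^p \<ge> 1 + p ln u for p = \<beta> and, with weight
  \<beta>/2, for p = -2; the logarithms cancel.\<close>

lemma rate_constant_le: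
  assumes \<rho>: "0 < \<rho>"
  shows "rate_constant \<beta> c \<le> c * \<rho> powr \<beta> + pi\<^sup>2 / (8 * \<rho>\<^sup>2)"
proof -
  define \<rho>' where "\<rho>' = optimal_radius \<beta> c"
  define u where "u = \<rho> / \<rho>'"
  have \<rho>': "0 < \<rho>'" using optimal_radius_pos by (simp add: \<rho>'_def)
  have u: "0 < u" "\<rho> = \<rho>' * u" using \<rho> \<rho>' by (auto simp: u_def)
  have tangent: "1 + p * ln u \<le> u powr p" for p
    using exp_ge_add_one_self[of "p * ln u"] u by (simp add: powr_def)
  have "1 + \<beta> / 2 \<le> u powr \<beta> + \<beta> / 2 * u powr (- 2)"
    using tangent[of \<beta>] mult_left_mono[OF tangent[of "- 2"], of "\<beta> / 2"] beta
    by (simp add: algebra_simps)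
  then have "c * \<rho>' powr \<beta> * (1 + \<beta> / 2) \<le> c * \<rho>' powr \<beta> * (u powr \<beta> + \<beta> / 2 * u powr (- 2))"
    using c by (intro mult_left_mono) auto
  also have "\<dots> = c * \<rho> powr \<beta> + (\<beta> / 2 * (c * \<rho>' powr \<beta>)) / u\<^sup>2"
    using u \<rho>' by (simp add: powr_mult powr_minus field_simps)
  also have "\<dots> = c * \<rho> powr \<beta> + pi\<^sup>2 / (8 * \<rho>\<^sup>2)"
    unfolding \<rho>'_def optimal_radius_balance[symmetric] using u by (simp add: \<rho>'_def power_mult_distrib)
  finally show ?thesis
    unfolding rate_constant_eq \<rho>'_def by (simp add: field_simps)
qed

end

section \<open>Logarithmic asymptotics of the confinement probability\<close>

lemma filterlim_powr_at_top:
  fixes a :: real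
  assumes "0 < a"
  shows "filterlim (\<lambda>x. x powr a) at_top at_top"
proof -
  have "filterlim (\<lambda>x::real. exp (a * ln x)) at_top at_top"
    using assms by (intro filterlim_compose[OF exp_at_top]
      filterlim_tendsto_pos_mult_at_top[OF tendsto_const _ ln_at_top])
  moreover have "\<forall>\<^sub>F x in at_top. exp (a * ln x) = x powr a"
    using eventually_gt_at_top[of 0] by eventually_elim (simp add: powr_def)
  ultimately show ?thesis
    using filterlim_cong[OF refl refl] by fast
qed

text \<open>Isolates the analysis from the probability: \<open>p\<close> stands for the tail of
  \<xi> and \<open>A\<close> for the confinement probability, and the two estimates
  \<open>lower\<close> and \<open>upper\<close> are all that is used about Brownian motion.\<close>

locale confinement_bounds =
  fixes \<beta> c :: real and p A :: "real \<Rightarrow> real"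
  assumes beta: "\<beta> > 0" and c: "c > 0"
    and p_nonneg: "\<And>r. 0 \<le> p r"
    and tail: "(\<lambda>r. - ln (p r)) \<sim>[at_top] (\<lambda>r. c * r powr \<beta>)"
    and lower: "\<And>t r. 0 < t \<Longrightarrow> 0 < r \<Longrightarrow> p r * exp (- (pi\<^sup>2 * t / (8 * r\<^sup>2))) \<le> A t"
    and upper: "\<And>t q x N. 0 < t \<Longrightarrow> 1 < q \<Longrightarrow> (\<And>k::nat. 0 < x k) \<Longrightarrow>
      cos (pi / (2 * q)) * A t \<le> exp (- (pi\<^sup>2 * t / (8 * (q * x 0)\<^sup>2)))
        + (\<Sum>k<N. p (x k) * exp (- (pi\<^sup>2 * t / (8 * (q * x (Suc k))\<^sup>2)))) + p (x N)"
begin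

abbreviation "K \<equiv> rate_constant \<beta> c"
abbreviation "s t \<equiv> t powr (1 / (2 + \<beta>))"
abbreviation "T t \<equiv> t powr (\<beta> / (2 + \<beta>))"

lemmas K_pos = rate_constant_pos[OF beta c]

lemma s_at_top: "filterlim s at_top at_top"
  using beta by (intro filterlim_powr_at_top) auto

lemma T_at_top: "filterlim T at_top at_top"
  using beta by (intro filterlim_powr_at_top) auto

lemma scaled_radius_powr: "0 < \<rho> \<Longrightarrow> (\<rho> * s t) powr \<beta> = \<rho> powr \<beta> * T t"
  by (simp add: powr_mult powr_powr)

text \<open>The exponents of \<open>T t\<close> and \<open>(s t)\<^sup>2\<close> add up to 1.
  Together with \<open>scaled_radius_powr\<close> this shows that at radius
  \<open>\<rho> * s t\<close> tail cost and confinement cost are both multiples of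
  \<open>T t\<close>.\<close>

lemma scaled_time:
  assumes "0 < t" "0 < \<rho>"
  shows "pi\<^sup>2 * t / (8 * (\<rho> * s t)\<^sup>2) = pi\<^sup>2 / (8 * \<rho>\<^sup>2) * T t"
proof -
  have "T t * (s t)\<^sup>2 = t powr (\<beta> / (2 + \<beta>)) * t powr (2 / (2 + \<beta>))"
    using assms by (simp add: powr_powr flip: powr_numeral)
  also have "\<dots> = t powr (\<beta> / (2 + \<beta>) + 2 / (2 + \<beta>))" by (simp add: powr_add)
  also have "\<beta> / (2 + \<beta>) + 2 / (2 + \<beta>) = 1" using beta by (simp flip: add_divide_distrib)
  finally have "T t * (s t)\<^sup>2 = t" using assms by simp
  then show ?thesis using assms by (simp add: field_simps)
qed

lemma tail_ratio: "((\<lambda>r. - ln (p r) / (c * r powr \<beta>)) \<longlongrightarrow> 1) at_top"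
proof (rule asymp_equivD_strong[OF tail])
  show "\<forall>\<^sub>F r in at_top. - ln (p r) \<noteq> 0 \<or> c * r powr \<beta> \<noteq> 0"
    using eventually_gt_at_top[of 0] by eventually_elim (use c in auto)
qed

lemma tail_pos: "\<forall>\<^sub>F r in at_top. 0 < p r"
proof -
  have "\<forall>\<^sub>F r in at_top. 0 < - ln (p r) / (c * r powr \<beta>)"
    using order_tendstoD(1)[OF tail_ratio, of 0] by simp
  then show ?thesis
  proof eventually_elim
    case (elim r)
    \<comment> \<open>By the convention \<open>ln 0 = 0\<close>, a vanishing tail would make the
      quotient 0, against its positivity.\<close>
    then have "p r \<noteq> 0" by (intro notI) simp
    then show ?case using p_nonneg[of r] by simp
  qed
qed

lemma scaled_tail_ratio:
  assumes "0 < \<rho>"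
  shows "((\<lambda>t. - ln (p (\<rho> * s t)) / T t) \<longlongrightarrow> c * \<rho> powr \<beta>) at_top"
proof -
  have "filterlim (\<lambda>t. \<rho> * s t) at_top at_top"
    using assms s_at_top by (intro filterlim_tendsto_pos_mult_at_top[OF tendsto_const]) auto
  from tendsto_mult[OF filterlim_compose[OF tail_ratio this] tendsto_const[of "c * \<rho> powr \<beta>"]]
  have "((\<lambda>t. - ln (p (\<rho> * s t)) / (c * (\<rho> powr \<beta> * T t)) * (c * \<rho> powr \<beta>)) \<longlongrightarrow> c * \<rho> powr \<beta>) at_top"
    using assms by (simp add: scaled_radius_powr)
  then show ?thesis
    by (rule Lim_transform_eventually) (use assms c in \<open>auto simp: field_simps\<close>)
qed

lemma scaled_tail_pos: "0 < \<rho> \<Longrightarrow> \<forall>\<^sub>F t in at_top. 0 < p (\<rho> * s t)"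
  using s_at_top filterlim_tendsto_pos_mult_at_top[OF tendsto_const, of \<rho> s at_top]
  by (intro eventually_compose_filterlim[OF tail_pos]) auto

text \<open>The tail is known only up to a factor tending to 1 in the exponent; giving up the factor
  \<theta> turns the limit into an inequality.\<close>

lemma eventually_scaled_tail_le:
  assumes \<rho>: "0 < \<rho>" and \<theta>: "\<theta> < 1"
  shows "\<forall>\<^sub>F t in at_top. p (\<rho> * s t) \<le> exp (- (\<theta> * (c * \<rho> powr \<beta>) * T t))"
proof -
  have "\<theta> * (c * \<rho> powr \<beta>) < c * \<rho> powr \<beta>" using \<theta> \<rho> c by simp
  from order_tendstoD(1)[OF scaled_tail_ratio[OF \<rho>] this] scaled_tail_pos[OF \<rho>] eventually_gt_at_top[of 0]
  show ?thesis
  proof eventually_elim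
    case (elim t)
    then have "ln (p (\<rho> * s t)) \<le> - (\<theta> * (c * \<rho> powr \<beta>) * T t)"
      by (simp add: field_simps)
    then have "exp (ln (p (\<rho> * s t))) \<le> exp (- (\<theta> * (c * \<rho> powr \<beta>) * T t))"
      by (simp only: exp_le_cancel_iff)
    then show ?case using elim(2) by simp
  qed
qed

lemma A_pos: "\<forall>\<^sub>F t in at_top. 0 < A t"
  using scaled_tail_pos[OF zero_less_one] eventually_gt_at_top[of 0]
proof eventually_elim
  case (elim t)
  then have "0 < p (1 * s t) * exp (- (pi\<^sup>2 * t / (8 * (1 * s t)\<^sup>2)))" by simp
  also have "\<dots> \<le> A t" using elim by (intro lower) auto
  finally show ?case .
qed

text \<open>The lower bound on \<open>A\<close> is used at the single radius
  \<open>\<rho> * s t\<close> with the optimal \<rho>, where the two costs add up to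
  \<open>K\<close>.\<close>

lemma rate_upper:
  assumes "1 < a"
  shows "\<forall>\<^sub>F t in at_top. - ln (A t) / (K * T t) < a"
proof -
  define \<rho> where "\<rho> = optimal_radius \<beta> c"
  have \<rho>: "0 < \<rho>" unfolding \<rho>_def by (rule optimal_radius_pos[OF beta c])
  have "((\<lambda>t. - ln (p (\<rho> * s t)) / T t + pi\<^sup>2 / (8 * \<rho>\<^sup>2)) \<longlongrightarrow> c * \<rho> powr \<beta> + pi\<^sup>2 / (8 * \<rho>\<^sup>2)) at_top"
    by (intro tendsto_add tendsto_const scaled_tail_ratio[OF \<rho>])
  then have lim: "((\<lambda>t. - ln (p (\<rho> * s t)) / T t + pi\<^sup>2 / (8 * \<rho>\<^sup>2)) \<longlongrightarrow> K) at_top"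
    unfolding \<rho>_def rate_constant_attained[OF beta c] .
  have "K < a * K" using assms K_pos by simp
  from order_tendstoD(2)[OF lim this] scaled_tail_pos[OF \<rho>] eventually_gt_at_top[of 0]
  show ?thesis
  proof eventually_elim
    case (elim t)
    have T: "0 < T t" using elim by simp
    have "p (\<rho> * s t) * exp (- (pi\<^sup>2 / (8 * \<rho>\<^sup>2) * T t)) \<le> A t"
      using lower[of t "\<rho> * s t"] elim \<rho> scaled_time[of t \<rho>] by simp
    then have "ln (p (\<rho> * s t) * exp (- (pi\<^sup>2 / (8 * \<rho>\<^sup>2) * T t))) \<le> ln (A t)"
      using elim by (intro ln_mono) auto
    then have "- ln (A t) \<le> - ln (p (\<rho> * s t)) + pi\<^sup>2 / (8 * \<rho>\<^sup>2) * T t"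
      using elim by (simp add: ln_mult)
    also have "\<dots> = (- ln (p (\<rho> * s t)) / T t + pi\<^sup>2 / (8 * \<rho>\<^sup>2)) * T t"
      using T by (simp only: distrib_right) simp
    also have "\<dots> < a * K * T t"
      using elim T by (intro mult_strict_right_mono) auto
    finally show ?case
      using T K_pos pos_divide_less_eq[of "K * T t" "- ln (A t)" a] by (simp only: mult_pos_pos mult.assoc)
  qed
qed

text \<open>The values of \<open>\<xi>\<close> are discretised along the geometric grid \<open>\<rho>\<^sub>0 q\<^sup>k s(t)\<close>. The ratio \<open>q\<close> is
  lost once between neighbouring grid points and once in the upper confinement estimate, so that
  \<open>\<theta> = q\<^sup>-\<^sup>4\<close> is the total loss in the exponent.\<close>

lemma A_le_exp:
  assumes \<theta>: "0 < \<theta>" "\<theta> < 1"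
  obtains L where "0 < L" "\<forall>\<^sub>F t in at_top. A t \<le> L * exp (- (\<theta> * K * T t))"
proof -
  define q where "q = root 4 (1 / \<theta>)"
  have q: "1 < q" using \<theta> by (simp add: q_def)
  have q4: "q ^ 4 = 1 / \<theta>" using \<theta> by (simp add: q_def)
  \<comment> \<open>Solves pi^2 / (8 (q \<rho>0)^2) = K, so that for the smallest radius confinement
    alone already costs \<open>K\<close>.\<close>
  define \<rho>0 where "\<rho>0 = pi / (q * sqrt (8 * K))"
  have \<rho>0: "0 < \<rho>0" using q K_pos by (simp add: \<rho>0_def)
  define \<rho> where "\<rho> k = \<rho>0 * q ^ k" for k
  have \<rho>: "0 < \<rho> k" for k using \<rho>0 q by (simp add: \<rho>_def)
  have first: "pi\<^sup>2 / (8 * (q * \<rho> 0)\<^sup>2) = K"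
    using q K_pos by (simp add: \<rho>_def \<rho>0_def power_divide power_mult_distrib)
  obtain N where "(K / c) powr (1 / \<beta>) / \<rho>0 < q ^ N"
    using real_arch_pow[OF q] by blast
  then have "(K / c) powr (1 / \<beta>) \<le> \<rho> N"
    using \<rho>0 by (simp add: \<rho>_def field_simps)
  then have "((K / c) powr (1 / \<beta>)) powr \<beta> \<le> \<rho> N powr \<beta>"
    using beta by (intro powr_mono2) auto
  then have last: "K \<le> c * \<rho> N powr \<beta>"
    using beta c K_pos by (simp add: powr_powr field_simps)
  \<comment> \<open>Since \<open>q * \<rho> (Suc k)\<close> is \<open>q\<^sup>2 * \<rho> k\<close>,
    its confinement cost is exactly \<theta> times that of \<open>\<rho> k\<close>. Tail and
    confinement thus both carry the factor \<theta>, and minimality of \<open>K\<close>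
    applies.\<close>
  have middle: "\<theta> * K \<le> \<theta> * (c * \<rho> k powr \<beta>) + pi\<^sup>2 / (8 * (q * \<rho> (Suc k))\<^sup>2)" for k
  proof -
    have "(q * \<rho> (Suc k))\<^sup>2 = q ^ 4 * (\<rho> k)\<^sup>2"
      by (simp add: \<rho>_def power_mult_distrib power2_eq_square power4_eq_xxxx)
    then have "pi\<^sup>2 / (8 * (q * \<rho> (Suc k))\<^sup>2) = \<theta> * (pi\<^sup>2 / (8 * (\<rho> k)\<^sup>2))"
      by (simp add: q4)
    then show ?thesis
      using mult_left_mono[OF rate_constant_le[OF beta c \<rho>[of k]], of \<theta>] \<theta> by (simp add: distrib_left)
  qed
  have "pi / (2 * q) < pi / 2" using q by (simp add: field_simps)
  then have cos: "0 < cos (pi / (2 * q))"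
    using q by (intro cos_gt_zero_pi) (auto intro: less_trans[of _ 0])
  have "\<forall>\<^sub>F t in at_top. \<forall>k\<in>{..N}. p (\<rho> k * s t) \<le> exp (- (\<theta> * (c * \<rho> k powr \<beta>) * T t))"
    by (intro eventually_ball_finite ballI eventually_scaled_tail_le \<rho> \<theta>) auto
  then have "\<forall>\<^sub>F t in at_top. A t \<le> (real N + 2) / cos (pi / (2 * q)) * exp (- (\<theta> * K * T t))"
    using eventually_gt_at_top[of 0]
  proof eventually_elim
    case (elim t)
    let ?e = "exp (- (\<theta> * K * T t))"
    have T: "0 < T t" using elim by simp
    have E: "exp (- (pi\<^sup>2 * t / (8 * (q * (\<rho> k * s t))\<^sup>2))) = exp (- (pi\<^sup>2 / (8 * (q * \<rho> k)\<^sup>2) * T t))" for k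
      using scaled_time[of t "q * \<rho> k"] elim q \<rho>[of k] by (simp add: mult.assoc)
    have "cos (pi / (2 * q)) * A t \<le> exp (- (pi\<^sup>2 / (8 * (q * \<rho> 0)\<^sup>2) * T t))
        + (\<Sum>k<N. p (\<rho> k * s t) * exp (- (pi\<^sup>2 / (8 * (q * \<rho> (Suc k))\<^sup>2) * T t))) + p (\<rho> N * s t)"
      using upper[of t q "\<lambda>k. \<rho> k * s t" N] elim q \<rho> by (simp only: E) simp
    \<comment> \<open>Each of the \<open>N + 2\<close> terms decays at least at rate \<theta> K, and
      their number does not depend on \<open>t\<close>.\<close>
    also have "\<dots> \<le> ?e + (\<Sum>k<N. ?e) + ?e"
    proof (intro add_mono sum_mono)
      show "exp (- (pi\<^sup>2 / (8 * (q * \<rho> 0)\<^sup>2) * T t)) \<le> ?e"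
        unfolding first using T \<theta> K_pos by simp
      have "p (\<rho> N * s t) \<le> exp (- (\<theta> * (c * \<rho> N powr \<beta>) * T t))" using elim by simp
      also have "\<dots> \<le> ?e" using last T \<theta> by simp
      finally show "p (\<rho> N * s t) \<le> ?e" .
      fix k assume "k \<in> {..<N}"
      then have "p (\<rho> k * s t) * exp (- (pi\<^sup>2 / (8 * (q * \<rho> (Suc k))\<^sup>2) * T t))
          \<le> exp (- (\<theta> * (c * \<rho> k powr \<beta>) * T t)) * exp (- (pi\<^sup>2 / (8 * (q * \<rho> (Suc k))\<^sup>2) * T t))"
        using elim by (intro mult_right_mono) auto
      also have "\<dots> = exp (- ((\<theta> * (c * \<rho> k powr \<beta>) + pi\<^sup>2 / (8 * (q * \<rho> (Suc k))\<^sup>2)) * T t))"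
        by (simp add: distrib_right flip: exp_add)
      also have "\<dots> \<le> ?e"
        using mult_right_mono[OF middle[of k], of "T t"] T by simp
      finally show "p (\<rho> k * s t) * exp (- (pi\<^sup>2 / (8 * (q * \<rho> (Suc k))\<^sup>2) * T t)) \<le> ?e" .
    qed
    also have "\<dots> = (real N + 2) * ?e" by (simp add: algebra_simps)
    finally show ?case using cos by (simp add: field_simps)
  qed
  moreover have "0 < (real N + 2) / cos (pi / (2 * q))" using cos by simp
  ultimately show ?thesis using that by blast
qed

text \<open>Provides the limit from which \<open>prob_exit_time_greater\<close> concludes that
  almost every path exits.\<close>

lemma A_tendsto_0: "(A \<longlongrightarrow> 0) at_top"
proof -
  obtain L where L: "0 < L" "\<forall>\<^sub>F t in at_top. A t \<le> L * exp (- (1 / 2 * K * T t))"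
    using A_le_exp[of "1 / 2"] by auto
  have "filterlim (\<lambda>t. 1 / 2 * K * T t) at_top at_top"
    using K_pos by (intro filterlim_tendsto_pos_mult_at_top[OF tendsto_const _ T_at_top]) simp
  then have "((\<lambda>t. exp (- (1 / 2 * K * T t))) \<longlongrightarrow> 0) at_top"
    by (intro filterlim_compose[OF exp_at_bot]) (simp add: filterlim_uminus_at_bot)
  then have "((\<lambda>t. L * exp (- (1 / 2 * K * T t))) \<longlongrightarrow> L * 0) at_top"
    by (intro tendsto_mult tendsto_const)
  then have lim: "((\<lambda>t. L * exp (- (1 / 2 * K * T t))) \<longlongrightarrow> 0) at_top" by simp
  show ?thesis
    by (rule tendsto_sandwich[OF eventually_mono[OF A_pos less_imp_le] L(2) tendsto_const lim])
qed

lemma rate_lower: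
  assumes "a < 1"
  shows "\<forall>\<^sub>F t in at_top. a < - ln (A t) / (K * T t)"
proof -
  \<comment> \<open>The midpoint of \<open>max a 0\<close> and 1; the maximum keeps \<theta>
    positive for negative \<open>a\<close>. The gap \<open>\<theta> - a\<close> then absorbs the
    constant \<open>ln L\<close>.\<close>
  define \<theta> where "\<theta> = (max a 0 + 1) / 2"
  have \<theta>: "0 < \<theta>" "\<theta> < 1" "a < \<theta>" using assms by (auto simp: \<theta>_def)
  obtain L where L: "0 < L" "\<forall>\<^sub>F t in at_top. A t \<le> L * exp (- (\<theta> * K * T t))"
    using A_le_exp[OF \<theta>(1,2)] .
  have "filterlim (\<lambda>t. (\<theta> - a) * K * T t) at_top at_top"
    using K_pos \<theta> by (intro filterlim_tendsto_pos_mult_at_top[OF tendsto_const _ T_at_top]) simp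
  then have "\<forall>\<^sub>F t in at_top. ln L < (\<theta> - a) * K * T t"
    by (simp add: filterlim_at_top_dense)
  with L(2) A_pos eventually_gt_at_top[of 0] show ?thesis
  proof eventually_elim
    case (elim t)
    have "ln (A t) \<le> ln (L * exp (- (\<theta> * K * T t)))"
      using elim by (intro ln_mono) auto
    also have "\<dots> = ln L - \<theta> * K * T t" using L(1) by (simp add: ln_mult)
    finally have "a * (K * T t) < - ln (A t)"
      using elim by (simp add: algebra_simps)
    moreover have "0 < K * T t" using elim K_pos by simp
    ultimately show ?case by (simp only: pos_less_divide_eq)
  qed
qed

lemma log_A_asymp: "(\<lambda>t. - ln (A t)) \<sim>[at_top] (\<lambda>t. K * T t)"
  by (intro asymp_equivI' order_tendstoI rate_lower rate_upper)

end

theorem theorem4p1: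
  fixes M :: "'a measure" and Y :: "real \<Rightarrow> 'a \<Rightarrow> real" and \<xi> :: "'a \<Rightarrow> real"
    and \<beta> c :: real
  assumes beta: "\<beta> > 0" and c: "c > 0"
    and BM: "brownian_motion M Y"
    and xi_rv: "\<xi> \<in> borel_measurable M"
    and xi_pos: "\<forall>\<omega>\<in>space M. \<xi> \<omega> > 0"
    and xi_tail: "(\<lambda>t. - ln (measure M {\<omega>\<in>space M. \<xi> \<omega> > t})) \<sim>[at_top] (\<lambda>t. c * t powr \<beta>)"
    and indep: "prob_space.indep_set M (sets (vimage_algebra (space M) \<xi> borel))
                  (sets (vimage_algebra (space M) (\<lambda>\<omega>. restrict (\<lambda>t. Y t \<omega>) {0..})
                     (Pi\<^sub>M {0..} (\<lambda>_. borel))))"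
  shows "(\<lambda>t. - ln (measure M {\<omega>\<in>space M. exit_time Y \<xi> \<omega> > t})) \<sim>[at_top]
         (\<lambda>t. 2 powr (- 2 * \<beta> / (2 + \<beta>)) * ((2 + \<beta>) / 2) * c powr (2 / (2 + \<beta>))
              * \<beta> powr (- \<beta> / (2 + \<beta>)) * pi powr (2 * \<beta> / (2 + \<beta>)) * t powr (\<beta> / (2 + \<beta>)))"
proof -
  interpret confinement_bounds \<beta> c "\<lambda>r. measure M {\<omega>\<in>space M. \<xi> \<omega> > r}"
    "\<lambda>t. measure M (confined M Y \<xi> t)"
    by (rule confinement_bounds.intro[OF beta c measure_nonneg xi_tail
          prob_confined_ge[OF BM xi_rv indep] prob_confined_le[OF BM xi_rv indep]])
  have "\<forall>\<^sub>F t in at_top. - ln (measure M (confined M Y \<xi> t)) =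
      - ln (measure M {\<omega>\<in>space M. exit_time Y \<xi> \<omega> > t})"
    using eventually_gt_at_top[of 0]
    by eventually_elim (simp only: prob_exit_time_greater[OF BM xi_rv _ A_tendsto_0])
  from asymp_equiv_cong[OF this always_eventually[OF allI[OF refl]]] log_A_asymp
  have "(\<lambda>t. - ln (measure M {\<omega>\<in>space M. exit_time Y \<xi> \<omega> > t})) \<sim>[at_top] (\<lambda>t. K * T t)"
    by (rule iffD1)
  then show ?thesis
    unfolding rate_constant_def .
qed

end
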